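(* Let $D$ be a division ring, and let $u$ be an endomorphism of special type II of a finite-dimensional right $D$-vector space $V$. The following conditions are equivalent: (i) The supertrace of $u$ is zero, i.e. $\operatorname{str}(u)=\{0\}$. (ii) $u$ is represented, in some basis of $V$, by a matrix with all diagonal entries zero. (iii) $u$ is the sum of two nilpotent endomorphisms of $V$.
   Context: A division ring is an associative ring with $1\neq 0$ in which every nonzero element is invertible (not necessarily commutative). Let $C$ denote the center of $D$. Vector spaces are right $D$-vector spaces; the matrix $(m_{i,j})$ of an endomorphism $u$ in a basis $(e_1,\dots,e_n)$ is given by $u(e_j)=\sum_i e_i\,m_{i,j}$. For $\lambda\in C$, $\operatorname{id}_V\lambda$ denotes the endomorphism $x\mapsto x\lambda$. An endomorphism $u$ of a finite-dimensional $V$ with $\dim V\geq 2$ is of special type II when $u=\operatorname{id}_V\lambda+a$ for some $\lambda\in C$ and some endomorphism $a$ of $V$ of rank $1$. For a rank $1$ endomorphism $a$, the range of $a$ is a line invariant under $a$, so for each nonzero $x\in\operatorname{Im} a$ there is $q\in D$ with $a(x)=xq$; the conjugacy class $\{gqg^{-1}: g\in D\setminus\{0\}\}$ does not depend on $x$, and is called the supertrace $\operatorname{str}(a)$. For $u=\operatorname{id}_V\lambda+a$ of special type II, the supertrace is the conjugacy class $\operatorname{str}(u):=(\dim V)\lambda+\operatorname{str}(a)=\{(\dim V)\lambda+q : q\in\operatorname{str}(a)\}$; it does not depend on the choice of the decomposition $u=\operatorname{id}_V\lambda+a$. *)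

theory Defs
  imports Main
begin

text \<open>The distribution's vector spaces and modules have commutative scalars, so right vector
  spaces over a division ring are set up here. The type class \<^class>\<open>division_ring\<close>
  does not assume commutativity of multiplication.\<close>

definition center :: "'d::division_ring set" where
  "center = {c. \<forall>d. c * d = d * c}"

definition conj_class :: "'d::division_ring \<Rightarrow> 'd set" where
  "conj_class q = {g * q * inverse g | g. g \<noteq> 0}"

locale right_vector_space =
  fixes scale :: "'v::ab_group_add \<Rightarrow> 'd::division_ring \<Rightarrow> 'v" (infixl "\<cdot>" 75)
  assumes scale_add_left: "(x + y) \<cdot> a = x \<cdot> a + y \<cdot> a"
    and scale_add_right: "x \<cdot> (a + b) = x \<cdot> a + x \<cdot> b"
    and scale_mult: "x \<cdot> (a * b) = (x \<cdot> a) \<cdot> b"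
    and scale_one: "x \<cdot> 1 = x"
begin

text \<open>Families of \<open>n\<close> vectors are functions on \<^typ>\<open>nat\<close> of which only the values at
  \<open>0, \<dots>, n - 1\<close> matter.\<close>

definition span :: "nat \<Rightarrow> (nat \<Rightarrow> 'v) \<Rightarrow> 'v set" where
  "span n e = {\<Sum>i<n. e i \<cdot> c i | c. True}"

definition independent :: "nat \<Rightarrow> (nat \<Rightarrow> 'v) \<Rightarrow> bool" where
  "independent n e \<longleftrightarrow> (\<forall>c. (\<Sum>i<n. e i \<cdot> c i) = 0 \<longrightarrow> (\<forall>i<n. c i = 0))"

definition basis :: "nat \<Rightarrow> (nat \<Rightarrow> 'v) \<Rightarrow> 'v set \<Rightarrow> bool" where
  "basis n e S \<longleftrightarrow> independent n e \<and> span n e = S"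

definition finite_dim :: "'v set \<Rightarrow> bool" where
  "finite_dim S \<longleftrightarrow> (\<exists>n e. basis n e S)"

text \<open>Only meaningful for finite-dimensional subspaces.\<close>

definition dim :: "'v set \<Rightarrow> nat" where
  "dim S = (THE n. \<exists>e. basis n e S)"

definition endo :: "('v \<Rightarrow> 'v) \<Rightarrow> bool" where
  "endo u \<longleftrightarrow> (\<forall>x y. u (x + y) = u x + u y) \<and> (\<forall>x a. u (x \<cdot> a) = u x \<cdot> a)"

definition rank_one :: "('v \<Rightarrow> 'v) \<Rightarrow> bool" where
  "rank_one a \<longleftrightarrow> endo a \<and> finite_dim (range a) \<and> dim (range a) = 1"

definition nilpotent :: "('v \<Rightarrow> 'v) \<Rightarrow> bool" where
  "nilpotent u \<longleftrightarrow> endo u \<and> (\<exists>k. u ^^ k = (\<lambda>x. 0))"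

definition represents :: "nat \<Rightarrow> (nat \<Rightarrow> 'v) \<Rightarrow> (nat \<Rightarrow> nat \<Rightarrow> 'd) \<Rightarrow> ('v \<Rightarrow> 'v) \<Rightarrow> bool" where
  "represents n e m u \<longleftrightarrow> (\<forall>j<n. u (e j) = (\<Sum>i<n. e i \<cdot> m i j))"

definition type_II_decomp :: "('v \<Rightarrow> 'v) \<Rightarrow> 'd \<Rightarrow> ('v \<Rightarrow> 'v) \<Rightarrow> bool" where
  "type_II_decomp u l a \<longleftrightarrow> l \<in> center \<and> rank_one a \<and> u = (\<lambda>x. x \<cdot> l + a x)"

definition special_type_II :: "('v \<Rightarrow> 'v) \<Rightarrow> bool" where
  "special_type_II u \<longleftrightarrow> finite_dim UNIV \<and> dim UNIV \<ge> 2 \<and> (\<exists>l a. type_II_decomp u l a)"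

text \<open>The class picked by \<open>str_rank_one\<close> does not depend on the vector \<open>x\<close>, since
  \<open>a (x \<cdot> g) = (x \<cdot> g) \<cdot> (inverse g * q * g)\<close>. The one picked by \<open>str\<close> does not depend on the
  decomposition: two different scalars \<open>l, l'\<close> force the dimension to be 2 and the two
  rank-one supertraces to be those of the central elements \<open>l' - l\<close> and \<open>l - l'\<close>.\<close>

definition str_rank_one :: "('v \<Rightarrow> 'v) \<Rightarrow> 'd set" where
  "str_rank_one a =
     (THE K. \<exists>x q. x \<in> range a \<and> x \<noteq> 0 \<and> a x = x \<cdot> q \<and> K = conj_class q)"

definition str :: "('v \<Rightarrow> 'v) \<Rightarrow> 'd set" where
  "str u = (THE K. \<exists>l a. type_II_decomp u l a \<and>
     K = {of_nat (dim UNIV) * l + q | q. q \<in> str_rank_one a})"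

end

end

theory Submission
  imports Defs
begin

text \<open>Write \<open>u x = x l + y \<phi>(x)\<close> with \<open>l\<close> central, \<open>y \<noteq> 0\<close> and \<open>\<phi>\<close> a nonzero linear form on
  an \<open>n\<close>-dimensional space. The supertrace is the class of \<open>n l + \<phi>(y)\<close>, so (i) says
  \<open>\<phi>(y) = - n l\<close>. In that case, if \<open>l \<noteq> 0\<close>, there is a basis \<open>e\<close> with \<open>\<Sum> e\<^sub>i = y\<close> and
  \<open>\<phi>(e\<^sub>i) = - l\<close>, and its diagonal entries are \<open>l - l = 0\<close>; if \<open>l = 0\<close>, any basis starting
  with \<open>y\<close> will do. A zero-diagonal matrix is the sum of a strictly upper and a strictly lower
  triangular one.

  There is no usable trace over a division ring, so for a sum \<open>u = s + t\<close> of nilpotents one looks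
  at the cyclic vectors \<open>E\<^sub>i = s\<^sup>i y\<close>. Let \<open>m\<close> be minimal with \<open>E\<^sub>m = 0\<close>; by symmetry between
  \<open>s\<close> and \<open>t\<close> one may assume \<open>t\<^sup>m y = 0\<close>. As \<open>t x = x l + y \<phi>(x) - s x\<close>, the
  \<open>E\<^sub>m\<^sub>-\<^sub>1\<close>-coordinate of \<open>t\<^sup>m y\<close> is \<open>\<plusminus> (m l + \<phi>(y))\<close>, whence \<open>m l + \<phi>(y) = 0\<close>. If
  \<open>l \<noteq> 0\<close>, the span of the \<open>E\<^sub>i\<close> is the whole space, since otherwise \<open>l = s + t\<close> would hold on
  a nonzero quotient; hence \<open>m = n\<close>.\<close>

section \<open>The center and conjugacy classes\<close>

lemma center_diff: "a \<in> center \<Longrightarrow> b \<in> center \<Longrightarrow> a - b \<in> center"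
  by (simp add: center_def algebra_simps)

lemma center_minus: "a \<in> center \<Longrightarrow> - a \<in> center"
  by (simp add: center_def)

lemma center_of_nat_mult: "a \<in> center \<Longrightarrow> of_nat n * a \<in> center"
  by (induction n) (simp_all add: center_def algebra_simps)

lemma mem_conj_class: "q \<in> conj_class q"
  unfolding conj_class_def by (auto intro!: exI[of _ 1])

lemma conj_class_center:
  assumes "q \<in> center" shows "conj_class q = {q}"
proof -
  have "g * q = q * g" for g using assms by (simp add: center_def)
  then have "g * q * inverse g = q" if "g \<noteq> 0" for g
    using that by (simp add: mult.assoc)
  then show ?thesis
    using mem_conj_class[of q] by (auto simp: conj_class_def)
qed

lemma conj_class_conjugate_subset:
  fixes c :: "'d::division_ring"
  assumes c: "c \<noteq> 0" shows "conj_class (inverse c * q * c) \<subseteq> conj_class q"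
proof
  fix x assume "x \<in> conj_class (inverse c * q * c)"
  then obtain g where g: "g \<noteq> 0" "x = g * (inverse c * q * c) * inverse g"
    by (auto simp: conj_class_def)
  then have "x = (g * inverse c) * q * inverse (g * inverse c)"
    using c by (simp add: nonzero_inverse_mult_distrib nonzero_inverse_inverse_eq mult.assoc)
  moreover have "g * inverse c \<noteq> 0" using g c by simp
  ultimately show "x \<in> conj_class q" unfolding conj_class_def by blast
qed

text \<open>Conjugating back by \<open>inverse c\<close> turns the inclusion just shown into the
  reverse one. This is what makes the supertrace independent of the chosen vector of the
  range.\<close>

lemma conj_class_conjugate:
  fixes c :: "'d::division_ring"
  assumes c: "c \<noteq> 0" shows "conj_class (inverse c * q * c) = conj_class q"
proof
  have "inverse (inverse c) * (inverse c * q * c) * inverse c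
      = (c * inverse c) * q * (c * inverse c)"
    by (simp only: nonzero_inverse_inverse_eq[OF c] mult.assoc)
  also have "\<dots> = q" using c by simp
  finally show "conj_class q \<subseteq> conj_class (inverse c * q * c)"
    using conj_class_conjugate_subset[of "inverse c" "inverse c * q * c"] c by simp
qed (rule conj_class_conjugate_subset[OF c])

context right_vector_space
begin

section \<open>Elementary rules for scalars and endomorphisms\<close>

lemma scale_zero_left [simp]: "0 \<cdot> a = 0"
  using scale_add_left[of 0 0 a] by simp

lemma scale_zero_right [simp]: "x \<cdot> 0 = 0"
  using scale_add_right[of x 0 0] by simp

lemma scale_minus_left: "(- x) \<cdot> a = - (x \<cdot> a)"
  using scale_add_left[of "- x" x a] by (simp add: eq_neg_iff_add_eq_0)

lemma scale_minus_right: "x \<cdot> (- a) = - (x \<cdot> a)"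
  using scale_add_right[of x "- a" a] by (simp add: eq_neg_iff_add_eq_0)

lemma scale_diff_left: "(x - y) \<cdot> a = x \<cdot> a - y \<cdot> a"
  using scale_add_left[of x "- y" a] by (simp add: scale_minus_left)

lemma scale_diff_right: "x \<cdot> (a - b) = x \<cdot> a - x \<cdot> b"
  using scale_add_right[of x a "- b"] by (simp add: scale_minus_right)

lemmas scale_distribs = scale_add_left scale_add_right scale_minus_left scale_minus_right
  scale_diff_left scale_diff_right

lemma scale_sum_left: "(\<Sum>i\<in>I. f i) \<cdot> a = (\<Sum>i\<in>I. f i \<cdot> a)"
  by (induction I rule: infinite_finite_induct) (simp_all add: scale_add_left)

lemma scale_sum_right: "x \<cdot> (\<Sum>i\<in>I. f i) = (\<Sum>i\<in>I. x \<cdot> f i)"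
  by (induction I rule: infinite_finite_induct) (simp_all add: scale_add_right)

lemma scale_scale_inverse: "a \<noteq> 0 \<Longrightarrow> x \<cdot> a \<cdot> inverse a = x"
  by (simp add: scale_mult[symmetric] scale_one)

lemma scale_eq_0_iff [simp]: "x \<cdot> a = 0 \<longleftrightarrow> x = 0 \<or> a = 0"
  by (metis scale_scale_inverse scale_zero_left scale_zero_right)

lemma scale_left_cancel: "x \<noteq> 0 \<Longrightarrow> x \<cdot> a = x \<cdot> b \<longleftrightarrow> a = b"
  by (metis scale_diff_right scale_eq_0_iff eq_iff_diff_eq_0)

lemma endo_add: "endo f \<Longrightarrow> f (x + y) = f x + f y"
  and endo_scale: "endo f \<Longrightarrow> f (x \<cdot> a) = f x \<cdot> a"
  by (simp_all add: endo_def)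

lemma endo_zero: "endo f \<Longrightarrow> f 0 = 0"
  using endo_scale[of f 0 0] by simp

lemma endo_sum: "endo f \<Longrightarrow> f (\<Sum>i\<in>I. g i) = (\<Sum>i\<in>I. f (g i))"
  by (induction I rule: infinite_finite_induct) (simp_all add: endo_add endo_zero)

lemma endo_funpow: "endo f \<Longrightarrow> endo (f ^^ k)"
  by (induction k) (simp_all add: endo_def)

section \<open>Subspaces and spans\<close>

definition subspace :: "'v set \<Rightarrow> bool" where
  "subspace S \<longleftrightarrow> 0 \<in> S \<and> (\<forall>x\<in>S. \<forall>y\<in>S. x + y \<in> S) \<and> (\<forall>x\<in>S. \<forall>a. x \<cdot> a \<in> S)"

lemma subspace_minus: "subspace S \<Longrightarrow> x \<in> S \<Longrightarrow> - x \<in> S"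
  by (metis subspace_def scale_minus_right scale_one)

lemma subspace_diff: "subspace S \<Longrightarrow> x \<in> S \<Longrightarrow> y \<in> S \<Longrightarrow> x - y \<in> S"
  by (metis diff_conv_add_uminus subspace_def subspace_minus)

lemma subspace_add: "subspace S \<Longrightarrow> x \<in> S \<Longrightarrow> y \<in> S \<Longrightarrow> x + y \<in> S"
  by (simp add: subspace_def)

lemma subspace_scale: "subspace S \<Longrightarrow> x \<in> S \<Longrightarrow> x \<cdot> a \<in> S"
  by (simp add: subspace_def)

lemma subspace_sum: "subspace S \<Longrightarrow> (\<And>i. i \<in> I \<Longrightarrow> f i \<in> S) \<Longrightarrow> (\<Sum>i\<in>I. f i) \<in> S"
  by (induction I rule: infinite_finite_induct) (simp_all add: subspace_def)

lemma subspace_span: "subspace (span n e)"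
  unfolding subspace_def
proof (intro conjI ballI allI)
  show "0 \<in> span n e" unfolding span_def by (auto intro!: exI[of _ "\<lambda>_. 0"])
next
  fix x y assume "x \<in> span n e" "y \<in> span n e"
  then obtain c d where "x = (\<Sum>i<n. e i \<cdot> c i)" "y = (\<Sum>i<n. e i \<cdot> d i)"
    by (auto simp: span_def)
  then have "x + y = (\<Sum>i<n. e i \<cdot> (c i + d i))"
    by (simp add: scale_add_right sum.distrib)
  then show "x + y \<in> span n e" unfolding span_def by auto
next
  fix x a assume "x \<in> span n e"
  then obtain c where "x = (\<Sum>i<n. e i \<cdot> c i)" by (auto simp: span_def)
  then have "x \<cdot> a = (\<Sum>i<n. e i \<cdot> (c i * a))"
    by (simp add: scale_sum_left scale_mult)
  then show "x \<cdot> a \<in> span n e" unfolding span_def by auto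
qed

lemma spanE:
  assumes "x \<in> span n e"
  obtains c where "x = (\<Sum>i<n. e i \<cdot> c i)"
  using assms by (auto simp: span_def)

lemma span_sum: "(\<Sum>i<n. e i \<cdot> c i) \<in> span n e"
  by (auto simp: span_def)

lemma sum_scale_delta: "k < n \<Longrightarrow> (\<Sum>i<n. e i \<cdot> (if i = k then a else 0)) = e k \<cdot> a" for n k :: nat
  by (subst sum.remove[of _ k]) auto

lemma span_base: "k < n \<Longrightarrow> e k \<in> span n e"
  using span_sum[of e "\<lambda>i. if i = k then 1 else 0" n] by (simp add: sum_scale_delta scale_one)

lemma span_minimal: "subspace S \<Longrightarrow> (\<And>i. i < n \<Longrightarrow> e i \<in> S) \<Longrightarrow> span n e \<subseteq> S"
  by (auto elim!: spanE intro!: subspace_sum subspace_scale)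

lemma span_mono: "m \<le> n \<Longrightarrow> span m e \<subseteq> span n e"
  by (intro span_minimal subspace_span) (auto intro: span_base)

lemma endo_image_span:
  assumes "endo f" "subspace S" "\<And>i. i < n \<Longrightarrow> f (e i) \<in> S" "x \<in> span n e"
  shows "f x \<in> S"
  using assms(4)
proof (rule spanE)
  fix c assume "x = (\<Sum>i<n. e i \<cdot> c i)"
  then show ?thesis
    using assms(1-3) by (auto simp: endo_sum endo_scale intro!: subspace_sum subspace_scale)
qed

section \<open>Endomorphisms given on a basis\<close>

lemma endo_eqI:
  assumes "basis n e UNIV" "endo f" "endo g" "\<And>i. i < n \<Longrightarrow> f (e i) = g (e i)"
  shows "f = g"
proof
  fix x
  obtain c where "x = (\<Sum>i<n. e i \<cdot> c i)"
    using assms(1) by (metis UNIV_I basis_def spanE)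
  then show "f x = g x" using assms(2-4) by (simp add: endo_sum endo_scale)
qed

lemma endo_exists:
  assumes "basis n e UNIV"
  obtains f where "endo f" "\<And>j. j < n \<Longrightarrow> f (e j) = w j"
proof -
  have "\<exists>c. x = (\<Sum>i<n. e i \<cdot> c i)" for x
    using assms by (metis UNIV_I basis_def spanE)
  then obtain c where c: "x = (\<Sum>i<n. e i \<cdot> c x i)" for x by metis
  \<comment> \<open>The coordinates \<open>c x\<close> come from a mere choice; their uniqueness
    below \<open>n\<close> is what makes them additive and homogeneous in \<open>x\<close>.\<close>
  have uniq: "c x i = d i" if "x = (\<Sum>i<n. e i \<cdot> d i)" "i < n" for x d i
  proof -
    have "(\<Sum>i<n. e i \<cdot> (c x i - d i)) = 0"
      using c[of x] that(1) by (simp add: scale_diff_right sum_subtractf)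
    then show ?thesis using assms that(2) by (auto simp: basis_def independent_def)
  qed
  define f where "f x = (\<Sum>i<n. w i \<cdot> c x i)" for x
  have "c (x + y) i = c x i + c y i" if "i < n" for x y i
    using that c[of x] c[of y] by (intro uniq) (simp_all add: scale_add_right sum.distrib)
  moreover have "c (x \<cdot> a) i = c x i * a" if "i < n" for x a i
    using that c[of x] by (intro uniq) (simp_all add: scale_mult flip: scale_sum_left)
  ultimately have "endo f"
    by (simp add: endo_def f_def scale_add_right sum.distrib scale_sum_left scale_mult)
  moreover have "f (e j) = w j" if "j < n" for j
  proof -
    have "c (e j) i = (if i = j then 1 else 0)" if "i < n" for i
      using \<open>j < n\<close> that by (intro uniq) (simp_all add: sum_scale_delta scale_one)
    then have "f (e j) = (\<Sum>i<n. w i \<cdot> (if i = j then 1 else 0))" by (simp add: f_def)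
    then show ?thesis using that by (simp add: sum_scale_delta scale_one)
  qed
  ultimately show ?thesis using that by blast
qed

section \<open>Dimension and extension to a basis\<close>

lemma card_independent_le:
  assumes "finite I" "\<And>c. (\<Sum>i\<in>I. e i \<cdot> c i) = 0 \<Longrightarrow> \<forall>i\<in>I. c i = 0"
    and "\<And>i. i \<in> I \<Longrightarrow> e i \<in> span n f"
  shows "card I \<le> n"
  using assms
proof (induction n arbitrary: I e)
  case 0
  have "I = {}"
  proof (rule ccontr)
    assume "I \<noteq> {}"
    \<comment> \<open>The empty family spans only 0, so every \<open>e i\<close> is 0 and the
      relation with all coefficients 1 holds.\<close>
    moreover have "(\<Sum>i\<in>I. e i \<cdot> 1) = 0"
      using "0.prems"(3) by (intro sum.neutral) (auto simp: span_def)
    ultimately show False using "0.prems"(2)[of "\<lambda>_. 1"] by auto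
  qed
  then show ?case by simp
next
  case (Suc n)
  have "\<exists>c d. e i = f n \<cdot> c + d \<and> d \<in> span n f" if "i \<in> I" for i
    using Suc.prems(3)[OF that] by (auto elim!: spanE) (metis add.commute span_sum)
  then obtain c d where cd: "\<And>i. i \<in> I \<Longrightarrow> e i = f n \<cdot> c i + d i"
      "\<And>i. i \<in> I \<Longrightarrow> d i \<in> span n f" by metis
  show ?case
  proof (cases "\<forall>i\<in>I. c i = 0")
    case True
    then have "card I \<le> n" using Suc.prems cd by (intro Suc.IH[of I e]) auto
    then show ?thesis by simp
  next
    case False
    then obtain k where k: "k \<in> I" "c k \<noteq> 0" by blast
    define e' where "e' i = e i - e k \<cdot> (inverse (c k) * c i)" for i
    have "card (I - {k}) \<le> n"
    proof (rule Suc.IH[of _ e'])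
      show "finite (I - {k})" using Suc.prems(1) by simp
    next
      fix b assume b: "(\<Sum>i\<in>I - {k}. e' i \<cdot> b i) = 0"
      \<comment> \<open>A relation \<open>b\<close> among the \<open>e'\<close> becomes one among
        the \<open>e\<close>: the multiples of \<open>e k\<close> subtracted in \<open>e'\<close>
        are collected in the coefficient at \<open>k\<close>.\<close>
      define b' where "b' i = (if i = k then - (\<Sum>i\<in>I - {k}. inverse (c k) * c i * b i) else b i)"
        for i
      have "(\<Sum>i\<in>I. e i \<cdot> b' i) = e k \<cdot> b' k + (\<Sum>i\<in>I - {k}. e i \<cdot> b' i)"
        using k Suc.prems(1) by (simp add: sum.remove)
      also have "(\<Sum>i\<in>I - {k}. e i \<cdot> b' i) = (\<Sum>i\<in>I - {k}. e i \<cdot> b i)"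
        by (simp add: b'_def)
      also have "e k \<cdot> b' k + \<dots> = (\<Sum>i\<in>I - {k}. e' i \<cdot> b i)"
        by (simp add: b'_def e'_def scale_distribs scale_sum_right sum_subtractf scale_mult)
      finally have "\<forall>i\<in>I. b' i = 0" using b Suc.prems(2)[of b'] by simp
      then show "\<forall>i\<in>I - {k}. b i = 0" unfolding b'_def by (metis Diff_iff singletonI)
    next
      fix i assume i: "i \<in> I - {k}"
      have "f n \<cdot> c k \<cdot> (inverse (c k) * c i) = f n \<cdot> c i"
        using k(2) by (simp flip: scale_mult mult.assoc)
      then have "e' i = d i - d k \<cdot> (inverse (c k) * c i)"
        using i cd(1)[of i] cd(1)[OF k(1)] by (simp add: e'_def scale_add_left)
      then show "e' i \<in> span n f"
        using i k cd(2) by (auto intro!: subspace_diff subspace_scale subspace_span)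
    qed
    then show ?thesis using k Suc.prems(1) by (simp add: card_Diff_singleton_if)
  qed
qed

lemma independent_le_span:
  assumes "independent m e" "\<And>i. i < m \<Longrightarrow> e i \<in> span n f"
  shows "m \<le> n"
  using card_independent_le[of "{..<m}" e n f] assms by (auto simp: independent_def)

lemma dim_eq:
  assumes "basis n e S" shows "dim S = n"
  unfolding dim_def
proof (rule the_equality)
  show "\<exists>e. basis n e S" using assms by blast
next
  fix m assume "\<exists>e. basis m e S"
  then obtain f where "basis m f S" by blast
  then have "n \<le> m" "m \<le> n"
    using assms independent_le_span[of n e m f] independent_le_span[of m f n e]
    by (simp_all add: basis_def) (metis span_base)+
  then show "m = n" by simp
qed

lemma independent_extend:
  assumes "independent n e" "v \<notin> span n e"
  shows "independent (Suc n) (e(n := v))"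
  unfolding independent_def
proof (intro allI impI)
  fix c i assume c: "(\<Sum>i<Suc n. (e(n := v)) i \<cdot> c i) = 0" and i: "i < Suc n"
  have eq: "(\<Sum>i<n. e i \<cdot> c i) + v \<cdot> c n = 0" using c by simp
  have "c n = 0"
  proof (rule ccontr)
    assume "c n \<noteq> 0"
    have "v \<cdot> c n = - (\<Sum>i<n. e i \<cdot> c i)" using eq by (simp add: eq_neg_iff_add_eq_0 add.commute)
    then have "v \<cdot> c n \<in> span n e"
      by (simp add: span_sum subspace_minus subspace_span)
    then have "v \<cdot> c n \<cdot> inverse (c n) \<in> span n e" by (rule subspace_scale[OF subspace_span])
    then show False using \<open>c n \<noteq> 0\<close> assms(2) by (simp add: scale_scale_inverse)
  qed
  with eq assms(1) i show "c i = 0" by (auto simp: independent_def less_Suc_eq)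
qed

text \<open>The new basis vectors are taken from a prescribed generating set \<open>A\<close>. The
  zero-diagonal construction uses this with \<open>A\<close> the whole space and with
  \<open>A\<close> an affine hyperplane.\<close>

lemma extend_to_basis:
  assumes "finite_dim UNIV" "independent m e"
    and A: "\<And>S. subspace S \<Longrightarrow> A \<subseteq> S \<Longrightarrow> S = UNIV"
  obtains n b where "basis n b UNIV" "m \<le> n" "\<And>i. i < m \<Longrightarrow> b i = e i"
    "\<And>i. m \<le> i \<Longrightarrow> i < n \<Longrightarrow> b i \<in> A"
proof -
  \<comment> \<open>\<open>P n\<close> says that some independent family of size \<open>n\<close>
    extends \<open>e\<close> by vectors of \<open>A\<close>. Such sizes are bounded by the
    dimension, and a family of maximal size has all of \<open>A\<close> in its span.\<close>
  define P where "P n \<longleftrightarrow> (\<exists>b. independent n b \<and> m \<le> n \<and> (\<forall>i<m. b i = e i) \<and>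
    (\<forall>i. m \<le> i \<longrightarrow> i < n \<longrightarrow> b i \<in> A))" for n
  obtain d f where "basis d f UNIV" using assms(1) by (auto simp: finite_dim_def)
  then have bd: "n \<le> d" if "P n" for n
    using that by (auto simp: P_def basis_def intro!: independent_le_span)
  have "P m" using assms(2) by (auto simp: P_def)
  then have Pn: "P (Greatest P)" using bd by (rule GreatestI_nat)
  define n where "n = Greatest P"
  from Pn obtain b where b: "independent n b" "m \<le> n" "\<And>i. i < m \<Longrightarrow> b i = e i"
    "\<And>i. m \<le> i \<Longrightarrow> i < n \<Longrightarrow> b i \<in> A" by (auto simp: P_def n_def)
  have "A \<subseteq> span n b"
  proof (rule ccontr)
    assume "\<not> A \<subseteq> span n b"
    then obtain v where v: "v \<in> A" "v \<notin> span n b" by blast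
    have "P (Suc n)"
      unfolding P_def
      using independent_extend[OF b(1) v(2)] v(1) b by (intro exI[of _ "b(n := v)"]) auto
    then have "Suc n \<le> n" unfolding n_def using bd by (rule Greatest_le_nat)
    then show False by simp
  qed
  then have "span n b = UNIV" by (intro A subspace_span)
  with b that show ?thesis by (auto simp: basis_def)
qed

section \<open>Rank one endomorphisms and the supertrace\<close>

text \<open>Here \<open>y\<close> spans the range and \<open>\<phi>\<close> is the coordinate along
  \<open>y\<close>. It takes the value 1 because \<open>y\<close> itself lies in the range.\<close>

lemma rank_oneE:
  assumes "rank_one a"
  obtains y \<phi> where "y \<noteq> 0" "a = (\<lambda>x. y \<cdot> \<phi> x)" "\<And>x z. \<phi> (x + z) = \<phi> x + \<phi> z"
    "\<And>x c. \<phi> (x \<cdot> c) = \<phi> x * c" "\<exists>x. \<phi> x = 1"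
proof -
  have a: "endo a" using assms by (simp add: rank_one_def)
  obtain n e where "basis n e (range a)" using assms by (auto simp: rank_one_def finite_dim_def)
  moreover from dim_eq[OF this] assms have "n = 1" by (simp add: rank_one_def)
  ultimately have e: "independent 1 e" "span 1 e = range a" by (simp_all add: basis_def)
  define y where "y = e 0"
  have y: "y \<noteq> 0"
    using e(1)[unfolded independent_def, rule_format, of "\<lambda>_. 1" 0] by (auto simp: y_def)
  have "\<exists>c. a x = y \<cdot> c" for x
  proof -
    have "a x \<in> span 1 e" using e by auto
    then show ?thesis by (auto elim!: spanE simp: y_def)
  qed
  then obtain \<phi> where \<phi>: "\<And>x. a x = y \<cdot> \<phi> x" by metis
  have "y \<in> span 1 e" unfolding y_def by (rule span_base) simp
  then obtain x where "y = a x" using e by auto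
  then have "y \<cdot> \<phi> x = y \<cdot> 1" using \<phi>[of x] by (simp add: scale_one)
  then have "\<phi> x = 1" using y by (simp add: scale_left_cancel)
  moreover have "y \<cdot> \<phi> (x + z) = y \<cdot> (\<phi> x + \<phi> z)" for x z
    using endo_add[OF a, of x z] by (simp add: \<phi> scale_add_right)
  moreover have "y \<cdot> \<phi> (x \<cdot> c) = y \<cdot> (\<phi> x * c)" for x c
    using endo_scale[OF a, of x c] by (simp add: \<phi> scale_mult)
  ultimately show ?thesis using y \<phi> by (intro that[of y \<phi>]) (auto simp: scale_left_cancel)
qed

text \<open>The vector \<open>y\<close> of the range gives \<open>q = \<phi> y\<close>; any other
  choice \<open>y \<cdot> c\<close> gives the conjugate
  \<open>inverse c * \<phi> y * c\<close>.\<close>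

lemma str_rank_one_eq:
  assumes y: "y \<noteq> 0" and a: "a = (\<lambda>x. y \<cdot> \<phi> x)"
    and scale: "\<And>x c. \<phi> (x \<cdot> c) = \<phi> x * c" and one: "\<exists>x. \<phi> x = 1"
  shows "str_rank_one a = conj_class (\<phi> y)"
  unfolding str_rank_one_def
proof (rule the_equality)
  obtain x where "\<phi> x = 1" using one by blast
  then have "y = a x" by (simp add: a scale_one)
  then show "\<exists>x q. x \<in> range a \<and> x \<noteq> 0 \<and> a x = x \<cdot> q \<and> conj_class (\<phi> y) = conj_class q"
    using y by (intro exI[of _ y] exI[of _ "\<phi> y"]) (auto simp: a)
next
  fix K assume "\<exists>x q. x \<in> range a \<and> x \<noteq> 0 \<and> a x = x \<cdot> q \<and> K = conj_class q"
  then obtain x q where x: "x \<in> range a" "x \<noteq> 0" "a x = x \<cdot> q" "K = conj_class q" by blast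
  then obtain c where c: "x = y \<cdot> c" "c \<noteq> 0" by (auto simp: a)
  then have "y \<cdot> (\<phi> y * c) = y \<cdot> (c * q)" using x(3) by (simp add: a scale scale_mult)
  then have "\<phi> y * c = c * q" using y by (simp add: scale_left_cancel)
  then have "q = inverse c * \<phi> y * c" using c(2)
    by (simp add: mult.assoc flip: mult.assoc[of "inverse c" c])
  then show "K = conj_class (\<phi> y)" using x(4) c(2) by (simp add: conj_class_conjugate)
qed

text \<open>If \<open>l \<noteq> l'\<close>, the nonzero scalar \<open>\<mu> = l - l'\<close> acts
  as a difference of two rank one maps. This forces dimension 2, and both sides become the singleton
  of \<open>l + l'\<close>.\<close>

lemma str_decomp_unique:
  assumes dec: "type_II_decomp u l a" "type_II_decomp u l' a'"
    and dim: "finite_dim UNIV" "dim UNIV \<ge> 2"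
  shows "{of_nat (dim UNIV) * l + q | q. q \<in> str_rank_one a}
    = {of_nat (dim UNIV) * l' + q | q. q \<in> str_rank_one a'}"
proof (cases "l = l'")
  case True
  have "x \<cdot> l + a x = x \<cdot> l' + a' x" for x
    using dec by (auto simp: type_II_decomp_def dest!: fun_cong[of _ _ x])
  then have "a = a'" using True by auto
  then show ?thesis using True by simp
next
  case False
  define \<mu> where "\<mu> = l - l'"
  have \<mu>: "\<mu> \<noteq> 0" "\<mu> \<in> center"
    using False dec by (auto simp: \<mu>_def type_II_decomp_def intro: center_diff)
  obtain y \<phi> where a: "y \<noteq> 0" "a = (\<lambda>x. y \<cdot> \<phi> x)"
    "\<And>x c. \<phi> (x \<cdot> c) = \<phi> x * c" "\<exists>x. \<phi> x = 1"
    using dec(1) by (auto simp: type_II_decomp_def elim!: rank_oneE)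
  obtain y' \<phi>' where a': "y' \<noteq> 0" "a' = (\<lambda>x. y' \<cdot> \<phi>' x)"
    "\<And>x c. \<phi>' (x \<cdot> c) = \<phi>' x * c" "\<exists>x. \<phi>' x = 1"
    using dec(2) by (auto simp: type_II_decomp_def elim!: rank_oneE)
  have eq: "x \<cdot> \<mu> = y' \<cdot> \<phi>' x - y \<cdot> \<phi> x" for x
  proof -
    have "x \<cdot> l + y \<cdot> \<phi> x = x \<cdot> l' + y' \<cdot> \<phi>' x"
      using dec by (auto simp: type_II_decomp_def a(2) a'(2) dest!: fun_cong[of _ _ x])
    then show ?thesis by (simp add: \<mu>_def scale_diff_right algebra_simps)
  qed
  obtain n e where e: "basis n e UNIV" using dim(1) by (auto simp: finite_dim_def)
  have n: "dim UNIV = n" using e by (rule dim_eq)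
  \<comment> \<open>Otherwise each \<open>x \<cdot> \<mu>\<close>, hence each \<open>x\<close>,
    would be a multiple of \<open>y\<close>, against dimension at least 2.\<close>
  have ind: "y' \<noteq> y \<cdot> c" for c
  proof
    assume c: "y' = y \<cdot> c"
    have "x \<in> span 1 (\<lambda>_. y)" for x
    proof -
      have "x = y \<cdot> ((c * \<phi>' x - \<phi> x) * inverse \<mu>)"
        using scale_scale_inverse[OF \<mu>(1), of x] eq[of x]
        by (simp add: c scale_mult scale_diff_right)
      moreover have "y \<in> span 1 (\<lambda>_. y)" using span_base[of 0 1 "\<lambda>_. y"] by simp
      ultimately show ?thesis by (metis subspace_scale subspace_span)
    qed
    then have "n \<le> 1" using e by (intro independent_le_span) (auto simp: basis_def)
    then show False using dim(2) n by simp
  qed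
  have "n \<le> 2"
  proof (rule independent_le_span)
    show "independent n e" using e by (simp add: basis_def)
    fix i
    let ?f = "\<lambda>i. if i = 0 then y else y' :: 'v"
    have "y \<in> span 2 ?f" "y' \<in> span 2 ?f"
      using span_base[of 0 2 ?f] span_base[of 1 2 ?f] by simp_all
    then have "e i \<cdot> \<mu> \<in> span 2 ?f"
      unfolding eq by (intro subspace_diff subspace_scale subspace_span)
    then have "e i \<cdot> \<mu> \<cdot> inverse \<mu> \<in> span 2 ?f" by (rule subspace_scale[OF subspace_span])
    then show "e i \<in> span 2 ?f" using \<mu>(1) by (simp add: scale_scale_inverse)
  qed
  then have n2: "dim UNIV = 2" using dim(2) n by simp
  \<comment> \<open>Evaluating \<open>eq\<close> at \<open>y\<close>, and later at
    \<open>y'\<close>, gives relations between \<open>y'\<close> and \<open>y\<close> in which, by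
    \<open>ind\<close>, the coefficient of \<open>y'\<close> must vanish.\<close>
  have 1: "y' \<cdot> \<phi>' y = y \<cdot> (\<mu> + \<phi> y)"
    using eq[of y] by (simp add: scale_add_right algebra_simps)
  have "\<phi>' y = 0"
  proof (rule ccontr)
    assume "\<phi>' y \<noteq> 0"
    from scale_scale_inverse[OF this, of y'] 1 have "y' = y \<cdot> ((\<mu> + \<phi> y) * inverse (\<phi>' y))"
      by (simp add: scale_mult)
    then show False using ind by blast
  qed
  then have \<phi>y: "\<phi> y = - \<mu>" using 1 a(1) by (simp add: eq_neg_iff_add_eq_0 add.commute)
  have 2: "y' \<cdot> (\<phi>' y' - \<mu>) = y \<cdot> \<phi> y'"
    using eq[of y'] by (simp add: scale_diff_right algebra_simps)
  have \<phi>y': "\<phi>' y' = \<mu>"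
  proof (rule ccontr)
    assume "\<phi>' y' \<noteq> \<mu>"
    then have "\<phi>' y' - \<mu> \<noteq> 0" by simp
    from scale_scale_inverse[OF this, of y'] 2 have "y' = y \<cdot> (\<phi> y' * inverse (\<phi>' y' - \<mu>))"
      by (simp add: scale_mult)
    then show False using ind by blast
  qed
  have "str_rank_one a = {- \<mu>}" "str_rank_one a' = {\<mu>}"
    using str_rank_one_eq[OF a] str_rank_one_eq[OF a'] \<mu>(2)
    by (simp_all add: \<phi>y \<phi>y' conj_class_center center_minus)
  moreover have "2 * l + - \<mu> = 2 * l' + \<mu>" by (simp add: \<mu>_def mult_2)
  ultimately show ?thesis by (simp add: n2)
qed

text \<open>The supertrace contains \<open>n l + \<phi>(y)\<close>. If this is 0, then
  \<open>\<phi>(y) = - n l\<close> is central, so its conjugacy class is a singleton.\<close>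

lemma str_eq_0_iff:
  assumes dec: "type_II_decomp u l a" and dim: "finite_dim UNIV" "dim UNIV \<ge> 2"
    and a: "y \<noteq> 0" "a = (\<lambda>x. y \<cdot> \<phi> x)" "\<And>x c. \<phi> (x \<cdot> c) = \<phi> x * c" "\<exists>x. \<phi> x = 1"
  shows "str u = {0} \<longleftrightarrow> of_nat (dim UNIV) * l + \<phi> y = 0"
proof -
  let ?n = "of_nat (dim UNIV) :: 'd"
  have "str u = {?n * l + q | q. q \<in> str_rank_one a}"
    unfolding str_def
  proof (rule the_equality)
    show "\<exists>l' a'. type_II_decomp u l' a' \<and>
        {?n * l + q | q. q \<in> str_rank_one a} = {?n * l' + q | q. q \<in> str_rank_one a'}"
      using dec by blast
  next
    fix K assume "\<exists>l a. type_II_decomp u l a \<and> K = {?n * l + q | q. q \<in> str_rank_one a}"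
    then show "K = {?n * l + q | q. q \<in> str_rank_one a}"
      using str_decomp_unique[OF _ dec dim] by blast
  qed
  then have *: "str u = {?n * l + q | q. q \<in> conj_class (\<phi> y)}"
    using str_rank_one_eq[OF a] by simp
  show ?thesis
  proof
    assume "str u = {0}"
    moreover have "?n * l + \<phi> y \<in> str u" using * mem_conj_class by blast
    ultimately show "?n * l + \<phi> y = 0" by simp
  next
    assume 0: "?n * l + \<phi> y = 0"
    have "l \<in> center" using dec by (simp add: type_II_decomp_def)
    moreover have "\<phi> y = - (?n * l)" using 0 by (simp add: eq_neg_iff_add_eq_0 add.commute)
    ultimately have "\<phi> y \<in> center" by (simp add: center_minus center_of_nat_mult)
    then show "str u = {0}" using * 0 by (simp add: conj_class_center)
  qed
qed

section \<open>From zero supertrace to a zero diagonal\<close>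

lemma zero_diagonal_if:
  assumes dim: "finite_dim UNIV" and y: "y \<noteq> 0"
    and \<phi>: "\<And>x z. \<phi> (x + z) = \<phi> x + \<phi> z" "\<And>x c. \<phi> (x \<cdot> c) = \<phi> x * c" "\<exists>x. \<phi> x = 1"
    and 0: "of_nat (dim UNIV) * l + \<phi> y = 0"
  shows "\<exists>n e m. basis n e UNIV \<and> represents n e m (\<lambda>x. x \<cdot> l + y \<cdot> \<phi> x) \<and> (\<forall>i<n. m i i = 0)"
proof -
  have ind: "independent 1 (\<lambda>_. y)" using y by (simp add: independent_def)
  show ?thesis
  proof (cases "l = 0")
    case True
    obtain n b where b: "basis n b UNIV" "1 \<le> n" "b 0 = y"
      by (rule extend_to_basis[OF dim ind, of UNIV]) auto
    \<comment> \<open>All images are multiples of \<open>b 0 = y\<close>, so only row 0 of the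
      matrix can be nonzero, and its diagonal entry is \<open>\<phi> y = 0\<close>.\<close>
    have "y \<cdot> \<phi> (b j) = (\<Sum>i<n. b i \<cdot> (if i = 0 then \<phi> (b j) else 0))" for j
      using b(2,3) by (simp add: sum_scale_delta)
    moreover have "\<phi> y = 0" using 0 True by simp
    ultimately show ?thesis
      using b True
      by (intro exI[of _ n] exI[of _ b] exI[of _ "\<lambda>i j. if i = 0 then \<phi> (b j) else 0"])
        (auto simp: represents_def)
  next
    case False
    define A where "A = {x. \<phi> x = - l}"
    have \<phi>0: "\<phi> 0 = 0" using \<phi>(2)[of 0 0] by simp
    have \<phi>m: "\<phi> (- x) = - \<phi> x" for x
      using \<phi>(1)[of "- x" x] by (simp add: \<phi>0 eq_neg_iff_add_eq_0)
    have \<phi>s: "\<phi> (\<Sum>i\<in>I. f i) = (\<Sum>i\<in>I. \<phi> (f i))" for f and I :: "nat set"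
      by (induction I rule: infinite_finite_induct) (simp_all add: \<phi>(1) \<phi>0)
    obtain x1 where x1: "\<phi> x1 = 1" using \<phi>(3) by blast
    define f where "f = x1 \<cdot> (- l)"
    have f: "\<phi> f = - l" by (simp add: f_def \<phi>(2) x1)
    \<comment> \<open>With \<open>f\<close> in \<open>A\<close> and \<open>k\<close> in the kernel
      of \<open>\<phi>\<close>, both \<open>f\<close> and \<open>f + k\<close> lie in
      \<open>A\<close>. So \<open>S\<close> contains the kernel and \<open>f\<close>; as
      \<open>l \<noteq> 0\<close>, it also contains \<open>x1\<close>, a complement of the
      kernel.\<close>
    have A: "S = UNIV" if S: "subspace S" "A \<subseteq> S" for S
    proof -
      have "x \<in> S" for x
      proof -
        define k where "k = x + x1 \<cdot> (- \<phi> x)"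
        have k: "\<phi> k = 0" by (simp add: k_def \<phi> x1)
        then have "f + k \<in> S" "f \<in> S" using S(2) f by (auto simp: A_def \<phi>(1))
        then have "f + k - f + f \<cdot> (inverse (- l) * \<phi> x) \<in> S"
          using S(1) by (intro subspace_add[OF _ subspace_diff subspace_scale])
        moreover have "f \<cdot> (inverse (- l) * \<phi> x) = x1 \<cdot> \<phi> x"
          using False unfolding f_def scale_mult by (subst scale_scale_inverse) auto
        ultimately have "f + k - f + x1 \<cdot> \<phi> x \<in> S" by simp
        then show ?thesis by (simp add: k_def scale_minus_right)
      qed
      then show ?thesis by blast
    qed
    obtain n b where b: "basis n b UNIV" "1 \<le> n" "b 0 = y" "\<And>i. 1 \<le> i \<Longrightarrow> i < n \<Longrightarrow> b i \<in> A"
      by (rule extend_to_basis[OF dim ind A]) auto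
    have n: "dim UNIV = n" using b(1) by (rule dim_eq)
    obtain k where k: "n = Suc k" using b(2) by (cases n) auto
    \<comment> \<open>Now \<open>e\<close> sums to \<open>y\<close> and \<open>\<phi>\<close> is \<open>- l\<close> on it, also at \<open>e 0\<close> because \<open>\<phi> y = - n l\<close>.\<close>
    define e where "e i = (if i = 0 then y - (\<Sum>j<k. b (Suc j)) else b i)" for i
    \<comment> \<open>Comparing \<open>sum_e\<close> with \<open>sum_b\<close> translates
      coordinates: \<open>c\<close> in \<open>e\<close> is \<open>c i - c 0\<close> in
      \<open>b\<close> for \<open>i > 0\<close>, with the entry at 0 unchanged. This transfers
      independence and spanning from \<open>b\<close> to \<open>e\<close>.\<close>
    have sum_e: "(\<Sum>i<n. e i \<cdot> c i) = y \<cdot> c 0 + (\<Sum>i<k. b (Suc i) \<cdot> (c (Suc i) - c 0))" for c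
      unfolding k sum.lessThan_Suc_shift
      by (simp add: e_def scale_distribs sum_subtractf scale_sum_left)
    have sum_b: "(\<Sum>i<n. b i \<cdot> c i) = y \<cdot> c 0 + (\<Sum>i<k. b (Suc i) \<cdot> c (Suc i))" for c
      unfolding k sum.lessThan_Suc_shift by (simp add: b(3))
    have "independent n e"
      unfolding independent_def
    proof (intro allI impI)
      fix c i assume c: "(\<Sum>i<n. e i \<cdot> c i) = 0" and i: "i < n"
      have "(\<Sum>i<n. b i \<cdot> (if i = 0 then c 0 else c i - c 0)) = 0"
        using c unfolding sum_e sum_b by simp
      then have "\<forall>i<n. (if i = 0 then c 0 else c i - c 0) = 0"
        using b(1) unfolding basis_def independent_def by fast
      then have "c 0 = 0" "i \<noteq> 0 \<Longrightarrow> c i - c 0 = 0" using i k by (auto split: if_splits)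
      then show "c i = 0" by (cases "i = 0") auto
    qed
    moreover have "x \<in> span n e" for x
    proof -
      obtain d where "x = (\<Sum>i<n. b i \<cdot> d i)" using b(1) by (metis UNIV_I basis_def spanE)
      then have "x = (\<Sum>i<n. e i \<cdot> (if i = 0 then d 0 else d i + d 0))"
        unfolding sum_e sum_b by simp
      then show ?thesis by (metis span_sum)
    qed
    ultimately have e: "basis n e UNIV" by (auto simp: basis_def)
    have y_e: "y = (\<Sum>i<n. e i)"
      using sum_e[of "\<lambda>_. 1"] by (simp add: scale_one)
    have \<phi>e: "\<phi> (e i) = - l" if "i < n" for i
    proof (cases "i = 0")
      case True
      have "\<phi> (e i) = \<phi> y - (\<Sum>j<k. \<phi> (b (Suc j)))"
        using True \<phi>(1)[of y "- (\<Sum>j<k. b (Suc j))"] by (simp add: e_def \<phi>m \<phi>s)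
      also have "(\<Sum>j<k. \<phi> (b (Suc j))) = (\<Sum>j<k. - l)"
        using b(4) k by (intro sum.cong) (auto simp: A_def)
      \<comment> \<open>The \<open>k = n - 1\<close> subtracted terms contribute
        \<open>+ k l\<close>, so \<open>- n l + k l = - l\<close> remains.\<close>
      also have "\<phi> y = - (of_nat n * l)" using 0 n by (simp add: eq_neg_iff_add_eq_0 add.commute)
      finally show ?thesis by (simp add: k algebra_simps)
    next
      case False
      then show ?thesis using b(4)[of i] that by (simp add: e_def A_def)
    qed
    have "represents n e (\<lambda>i j. (if i = j then l else 0) - l) (\<lambda>x. x \<cdot> l + y \<cdot> \<phi> x)"
      unfolding represents_def
    proof (intro allI impI)
      fix j assume j: "j < n"
      have "e j \<cdot> l + y \<cdot> \<phi> (e j) = e j \<cdot> l + (\<Sum>i<n. e i) \<cdot> (- l)"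
        using \<phi>e[OF j] y_e by metis
      also have "\<dots> = (\<Sum>i<n. e i \<cdot> ((if i = j then l else 0) - l))"
        using j by (simp add: scale_diff_right sum_subtractf sum_scale_delta scale_sum_left
            scale_minus_right)
      finally show "e j \<cdot> l + y \<cdot> \<phi> (e j) = (\<Sum>i<n. e i \<cdot> ((if i = j then l else 0) - l))" .
    qed
    then show ?thesis using e by (intro exI[of _ n] exI[of _ e] exI conjI) auto
  qed
qed

section \<open>From a zero diagonal to two nilpotents\<close>

text \<open>Reversing a basis turns strictly lower triangular matrices into strictly upper ones, so
  one nilpotency criterion covers both.\<close>

lemma basis_rev:
  assumes "basis n e S"
  shows "basis n (\<lambda>i. e (n - Suc i)) S"
proof -
  have rev: "(\<Sum>i<n. e (n - Suc i) \<cdot> c i) = (\<Sum>i<n. e i \<cdot> c (n - Suc i))" for c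
    by (subst sum.nat_diff_reindex[symmetric]) (auto intro!: sum.cong)
  have "independent n (\<lambda>i. e (n - Suc i))"
    unfolding independent_def rev
  proof (intro allI impI)
    fix c i assume "(\<Sum>i<n. e i \<cdot> c (n - Suc i)) = 0" "i < n"
    then have "\<forall>i<n. c (n - Suc i) = 0"
      using assms unfolding basis_def independent_def by fast
    moreover have "n - Suc i < n" using \<open>i < n\<close> by linarith
    ultimately have "c (n - Suc (n - Suc i)) = 0" by blast
    then show "c i = 0" using \<open>i < n\<close> by (simp add: Suc_diff_Suc)
  qed
  moreover have "span n (\<lambda>i. e (n - Suc i)) = span n e"
  proof
    show "span n (\<lambda>i. e (n - Suc i)) \<subseteq> span n e"
      by (intro span_minimal subspace_span span_base) auto
    show "span n e \<subseteq> span n (\<lambda>i. e (n - Suc i))"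
    proof (intro span_minimal subspace_span)
      fix i assume "i < n"
      then show "e i \<in> span n (\<lambda>i. e (n - Suc i))"
        using span_base[of "n - Suc i" n "\<lambda>i. e (n - Suc i)"] by (simp add: Suc_diff_Suc)
    qed
  qed
  ultimately show ?thesis using assms by (simp add: basis_def)
qed

text \<open>Each application of \<open>f\<close> goes down one step in the flag of the
  \<open>span j e\<close>, so \<open>f ^^ n\<close> maps everything into the span of no
  vectors.\<close>

lemma nilpotent_triangular:
  assumes e: "basis n e UNIV" and f: "endo f" "\<And>j. j < n \<Longrightarrow> f (e j) \<in> span j e"
  shows "nilpotent f"
proof -
  have "(f ^^ k) x \<in> span (n - k) e" for k x
  proof (induction k)
    case 0
    then show ?case using e by (simp add: basis_def)
  next
    case (Suc k)
    have "f ((f ^^ k) x) \<in> span (n - Suc k) e"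
    proof (rule endo_image_span[OF f(1) subspace_span _ Suc])
      fix i assume "i < n - k"
      then have "i < n" "i \<le> n - Suc k" by linarith+
      then show "f (e i) \<in> span (n - Suc k) e"
        using f(2)[of i] span_mono[of i "n - Suc k" e] by blast
    qed
    then show ?case by simp
  qed
  from this[of n] have "f ^^ n = (\<lambda>x. 0)" by (auto simp: span_def)
  then show ?thesis using f(1) by (auto simp: nilpotent_def)
qed

lemma nilpotent_sum_if_zero_diagonal:
  assumes e: "basis n e UNIV" "represents n e m u" "\<forall>i<n. m i i = 0" and u: "endo u"
  shows "\<exists>s t. nilpotent s \<and> nilpotent t \<and> u = (\<lambda>x. s x + t x)"
proof -
  obtain s where s: "endo s" "\<And>j. j < n \<Longrightarrow> s (e j) = (\<Sum>i<n. e i \<cdot> (if i < j then m i j else 0))"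
    using endo_exists[OF e(1), of "\<lambda>j. \<Sum>i<n. e i \<cdot> (if i < j then m i j else 0)"] by blast
  obtain t where t: "endo t" "\<And>j. j < n \<Longrightarrow> t (e j) = (\<Sum>i<n. e i \<cdot> (if j < i then m i j else 0))"
    using endo_exists[OF e(1), of "\<lambda>j. \<Sum>i<n. e i \<cdot> (if j < i then m i j else 0)"] by blast
  have "nilpotent s"
  proof (rule nilpotent_triangular[OF e(1) s(1)])
    fix j assume j: "j < n"
    have "e i \<cdot> (if i < j then m i j else 0) \<in> span j e" for i
      using subspace_span[of j e] span_base[of i j e]
      by (cases "i < j") (simp_all add: subspace_def)
    then show "s (e j) \<in> span j e"
      using j by (auto simp: s(2) intro!: subspace_sum subspace_span)
  qed
  moreover have "nilpotent t"
  proof (rule nilpotent_triangular[OF basis_rev[OF e(1)] t(1)])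
    fix j assume j: "j < n"
    let ?e = "\<lambda>i. e (n - Suc i)"
    \<comment> \<open>In the reversed basis \<open>e i\<close> has index \<open>n - Suc i\<close>,
      and \<open>n - Suc j < i\<close> means that this index is below \<open>j\<close>.\<close>
    have "e i \<cdot> (if n - Suc j < i then m i (n - Suc j) else 0) \<in> span j ?e" if "i < n" for i
    proof (cases "n - Suc j < i")
      case True
      then have "n - Suc i < j" using j that by linarith
      then have "?e (n - Suc i) \<in> span j ?e" by (rule span_base)
      then show ?thesis using that by (simp add: Suc_diff_Suc subspace_scale subspace_span)
    next
      case False
      then show ?thesis using subspace_span[of j ?e] by (simp add: subspace_def)
    qed
    then show "t (e (n - Suc j)) \<in> span j ?e"
      using j by (auto simp: t(2) intro!: subspace_sum subspace_span)
  qed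
  moreover have "u = (\<lambda>x. s x + t x)"
  proof (rule endo_eqI[OF e(1) u])
    show "endo (\<lambda>x. s x + t x)"
      using s(1) t(1) by (simp add: endo_def scale_add_left algebra_simps)
    fix j assume j: "j < n"
    then have "u (e j) = (\<Sum>i<n. e i \<cdot> m i j)" using e(2) by (simp add: represents_def)
    also have "\<dots> = s (e j) + t (e j)"
      \<comment> \<open>The two triangular parts omit exactly the diagonal entry
        \<open>m j j\<close>, which is 0.\<close>
      using e(3) j by (auto simp: s(2) t(2) simp flip: sum.distrib intro!: sum.cong)
    finally show "u (e j) = s (e j) + t (e j)" .
  qed
  ultimately show ?thesis by blast
qed

section \<open>From two nilpotents to zero supertrace\<close>

text \<open>Applying \<open>s ^^ (m - Suc i)\<close> to a relation kills the terms beyond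
  \<open>i\<close>, and the terms before \<open>i\<close> vanish by induction; only a nonzero
  multiple of \<open>c i\<close> could survive.\<close>

lemma independent_funpow:
  assumes s: "endo s" and m: "(s ^^ m) y = 0" "\<And>k. k < m \<Longrightarrow> (s ^^ k) y \<noteq> 0"
  shows "independent m (\<lambda>i. (s ^^ i) y)"
  unfolding independent_def
proof (intro allI impI)
  fix c i assume c: "(\<Sum>i<m. (s ^^ i) y \<cdot> c i) = 0" and "i < m"
  show "c i = 0"
    using \<open>i < m\<close>
  proof (induction i rule: less_induct)
    case (less i)
    define r where "r = m - Suc i"
    have high: "(s ^^ k) y = 0" if "m \<le> k" for k
      using that m(1) endo_zero[OF endo_funpow[OF s]]
      by (metis funpow_add le_add_diff_inverse2 o_apply)
    have "0 = (s ^^ r) (\<Sum>j<m. (s ^^ j) y \<cdot> c j)"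
      using c endo_zero[OF endo_funpow[OF s]] by simp
    also have "\<dots> = (\<Sum>j<m. (s ^^ (r + j)) y \<cdot> c j)"
      by (simp add: endo_sum[OF endo_funpow[OF s]] endo_scale[OF endo_funpow[OF s]] funpow_add)
    also have "\<dots> = (\<Sum>j\<in>{i}. (s ^^ (r + j)) y \<cdot> c j)"
    proof (rule sum.mono_neutral_right)
      show "\<forall>j\<in>{..<m} - {i}. (s ^^ (r + j)) y \<cdot> c j = 0"
      proof
        fix j assume j: "j \<in> {..<m} - {i}"
        show "(s ^^ (r + j)) y \<cdot> c j = 0"
        proof (cases "j < i")
          case True
          then show ?thesis using less by simp
        next
          case False
          then have "m \<le> r + j" using j less.prems by (auto simp: r_def)
          then show ?thesis by (simp add: high)
        qed
      qed
    qed (use less.prems in auto)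
    finally have "(s ^^ (r + i)) y \<cdot> c i = 0" by simp
    moreover have "(s ^^ (r + i)) y \<noteq> 0" using less.prems by (intro m(2)) (simp add: r_def)
    ultimately show ?case by simp
  qed
qed

text \<open>On the vectors \<open>E j\<close>, \<open>t\<close> is minus the shift plus
  \<open>l\<close> plus a multiple of \<open>y = E 0\<close>. The leading coefficient of
  \<open>t ^^ Suc k\<close> at \<open>y\<close> is therefore a sign; the next one gains one signed
  \<open>l\<close> per step, and \<open>\<phi> y\<close> enters at the first step.\<close>

lemma funpow_leading_terms:
  fixes s t :: "'v \<Rightarrow> 'v"
  assumes t: "endo t" and st: "\<And>x. s x + t x = x \<cdot> l + y \<cdot> \<phi> x"
  defines "E \<equiv> \<lambda>i. (s ^^ i) y"
  shows "(t ^^ Suc k) y - E (Suc k) \<cdot> (- 1) ^ Suc k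
      - E k \<cdot> ((- 1) ^ k * (of_nat (Suc k) * l + \<phi> y)) \<in> span k E"
proof (induction k)
  case 0
  have "t y = y \<cdot> l + y \<cdot> \<phi> y - s y" using st[of y] by (simp add: algebra_simps)
  then show ?case using subspace_span[of 0 E]
    by (simp add: E_def scale_distribs scale_one subspace_def)
next
  case (Suc k)
  have tE: "t (E j) = E j \<cdot> l + y \<cdot> \<phi> (E j) - E (Suc j)" for j
    using st[of "E j"] by (simp add: E_def algebra_simps)
  have E: "E j \<in> span (Suc k) E" if "j \<le> k" for j using that by (intro span_base) simp
  have y: "y \<in> span (Suc k) E" using E[of 0] by (simp add: E_def)
  define \<epsilon> :: 'd where "\<epsilon> = (- 1) ^ Suc k"
  define \<delta> where "\<delta> = (- 1) ^ k * (of_nat (Suc k) * l + \<phi> y)"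
  define r where "r = (t ^^ Suc k) y - E (Suc k) \<cdot> \<epsilon> - E k \<cdot> \<delta>"
  \<comment> \<open>\<open>t\<close> raises the index by at most one, so the remainder stays below
    the two leading terms.\<close>
  have "t r \<in> span (Suc k) E"
  proof (rule endo_image_span[OF t subspace_span])
    show "r \<in> span k E" using Suc by (simp add: r_def \<epsilon>_def \<delta>_def)
    fix i assume "i < k"
    then show "t (E i) \<in> span (Suc k) E"
      unfolding tE by (intro subspace_add subspace_diff subspace_scale subspace_span E y) auto
  qed
  \<comment> \<open>\<open>E (Suc k)\<close> arises twice: with \<open>l * \<epsilon>\<close> from
    its own image and with \<open>- \<delta>\<close> from the shift of \<open>E k\<close>. The sign
    \<open>\<epsilon>\<close> commutes with \<open>l\<close>.\<close>
  have coeff: "(- 1) ^ Suc k * (of_nat (Suc (Suc k)) * l + \<phi> y) = l * \<epsilon> - \<delta>"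
  proof -
    have "l * \<epsilon> = \<epsilon> * l" unfolding \<epsilon>_def by (cases "even (Suc k)") auto
    then show ?thesis by (simp add: \<epsilon>_def \<delta>_def algebra_simps)
  qed
  have "(t ^^ Suc (Suc k)) y = t (r + E (Suc k) \<cdot> \<epsilon> + E k \<cdot> \<delta>)"
    by (simp add: r_def)
  also have "\<dots> = t r + t (E (Suc k)) \<cdot> \<epsilon> + t (E k) \<cdot> \<delta>"
    using t by (simp add: endo_add endo_scale)
  also have "\<dots> = t r + (y \<cdot> \<phi> (E (Suc k)) \<cdot> \<epsilon> + E k \<cdot> l \<cdot> \<delta> + y \<cdot> \<phi> (E k) \<cdot> \<delta>)
      + E (Suc k) \<cdot> (l * \<epsilon> - \<delta>) + E (Suc (Suc k)) \<cdot> (- \<epsilon>)"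
    by (simp add: tE scale_distribs scale_mult algebra_simps)
  finally have "(t ^^ Suc (Suc k)) y - E (Suc (Suc k)) \<cdot> (- \<epsilon>) - E (Suc k) \<cdot> (l * \<epsilon> - \<delta>)
      = t r + (y \<cdot> \<phi> (E (Suc k)) \<cdot> \<epsilon> + E k \<cdot> l \<cdot> \<delta> + y \<cdot> \<phi> (E k) \<cdot> \<delta>)"
    by simp
  also have "\<dots> \<in> span (Suc k) E"
    using \<open>t r \<in> span (Suc k) E\<close>
    by (intro subspace_add subspace_scale subspace_span E y) auto
  finally show ?case unfolding coeff by (simp add: \<epsilon>_def)
qed

text \<open>The span contains \<open>y\<close> and is stable under \<open>s\<close> and
  \<open>t\<close>. Instead of forming the quotient, the proof computes with vectors modulo the
  span.\<close>

lemma span_funpow_eq_UNIV: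
  fixes s t :: "'v \<Rightarrow> 'v"
  assumes s: "endo s" "s ^^ p = (\<lambda>x. 0)" and t: "endo t" "t ^^ q = (\<lambda>x. 0)"
    and st: "\<And>x. s x + t x = x \<cdot> l + y \<cdot> \<phi> x" and l: "l \<noteq> 0"
    and m: "(s ^^ m) y = 0" "y \<noteq> 0"
  shows "span m (\<lambda>i. (s ^^ i) y) = UNIV"
proof (rule ccontr)
  let ?W = "span m (\<lambda>i. (s ^^ i) y)"
  assume "?W \<noteq> UNIV"
  then obtain v where v: "v \<notin> ?W" by blast
  have "0 < m" using m by (cases m) auto
  then have y: "y \<in> ?W" using span_base[of 0 m "\<lambda>i. (s ^^ i) y"] by simp
  have sW: "s x \<in> ?W" if "x \<in> ?W" for x
  proof (rule endo_image_span[OF s(1) subspace_span _ that])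
    fix i assume "i < m"
    then consider "Suc i < m" | "Suc i = m" by linarith
    then show "s ((s ^^ i) y) \<in> ?W"
    proof cases
      case 1
      then show ?thesis using span_base[of "Suc i" m "\<lambda>i. (s ^^ i) y"] by simp
    next
      case 2
      then have "s ((s ^^ i) y) = 0" using m(1) by auto
      then show ?thesis using subspace_span[of m] by (simp add: subspace_def)
    qed
  qed
  have teq: "t x = x \<cdot> l + y \<cdot> \<phi> x - s x" for x
    using st[of x] by (simp add: algebra_simps)
  have tW: "t x \<in> ?W" if "x \<in> ?W" for x
    unfolding teq by (intro subspace_add subspace_diff subspace_scale subspace_span sW y that)
  have "(s ^^ p) v \<in> ?W" using s(2) subspace_span[of m] by (simp add: subspace_def)
  moreover have "(s ^^ 0) v \<notin> ?W" using v by simp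
  \<comment> \<open>The last iterate of \<open>v\<close> under \<open>s\<close> outside the span
    represents a nonzero kernel vector of \<open>s\<close> on the quotient.\<close>
  ultimately obtain i where i: "(s ^^ i) v \<notin> ?W" "(s ^^ Suc i) v \<in> ?W"
    using ex_least_nat_less[of "\<lambda>i. (s ^^ i) v \<in> ?W" p] by blast
  \<comment> \<open>Modulo the span, \<open>s\<close> kills \<open>w\<close> and \<open>t\<close> multiplies it by \<open>l\<close>, so \<open>t\<close> is not nilpotent.\<close>
  define w where "w = (s ^^ i) v"
  have w: "w \<notin> ?W" "s w \<in> ?W" using i by (simp_all add: w_def)
  have "(t ^^ j) w - w \<cdot> l ^ j \<in> ?W" for j
  proof (induction j)
    case 0
    then show ?case using subspace_span[of m] by (simp add: scale_one subspace_def)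
  next
    case (Suc j)
    have "t ((t ^^ j) w - w \<cdot> l ^ j + w \<cdot> l ^ j) = t ((t ^^ j) w - w \<cdot> l ^ j) + t w \<cdot> l ^ j"
      using t(1) by (simp only: endo_add endo_scale)
    then have "(t ^^ Suc j) w - w \<cdot> l ^ Suc j
        = t ((t ^^ j) w - w \<cdot> l ^ j) + (y \<cdot> \<phi> w - s w) \<cdot> l ^ j"
      by (simp add: teq[of w] scale_distribs scale_mult algebra_simps)
    also have "\<dots> \<in> ?W"
      by (intro subspace_add subspace_diff subspace_scale subspace_span tW y w(2) Suc)
    finally show ?case .
  qed
  from this[of q] have "- (w \<cdot> l ^ q) \<in> ?W" using t(2) by simp
  then have "- (- (w \<cdot> l ^ q)) \<cdot> inverse (l ^ q) \<in> ?W"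
    by (rule subspace_scale[OF subspace_span subspace_minus[OF subspace_span]])
  then have "w \<in> ?W" using l by (simp add: scale_scale_inverse)
  then show False using w by simp
qed

text \<open>At exponent \<open>m\<close> both \<open>t ^^ m\<close> and \<open>s ^^ m\<close> kill
  \<open>y\<close>, so the second coefficient of the expansion must vanish by independence. This
  gives the equation with \<open>m\<close> in place of the dimension.\<close>

lemma nilpotent_sum_funpow_eq_0:
  fixes s t :: "'v \<Rightarrow> 'v"
  assumes s: "nilpotent s" and t: "nilpotent t"
    and st: "\<And>x. s x + t x = x \<cdot> l + y \<cdot> \<phi> x" and y: "y \<noteq> 0"
    and m: "(s ^^ m) y = 0" "\<And>k. k < m \<Longrightarrow> (s ^^ k) y \<noteq> 0" "(t ^^ m) y = 0"
  shows "of_nat (dim UNIV) * l + \<phi> y = 0"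
proof -
  define E where "E = (\<lambda>i. (s ^^ i) y)"
  obtain p q where s': "endo s" "s ^^ p = (\<lambda>x. 0)" and t': "endo t" "t ^^ q = (\<lambda>x. 0)"
    using s t by (auto simp: nilpotent_def)
  obtain k where k: "m = Suc k" using m(1) y by (cases m) auto
  have ind: "independent m E" unfolding E_def using s'(1) m by (intro independent_funpow)
  have "- (E k \<cdot> ((- 1) ^ k * (of_nat m * l + \<phi> y))) \<in> span k E"
    using funpow_leading_terms[OF t'(1) st, where k = k] m(1,3) by (simp add: k E_def)
  from subspace_minus[OF subspace_span this]
  obtain c where c: "E k \<cdot> ((- 1) ^ k * (of_nat m * l + \<phi> y)) = (\<Sum>i<k. E i \<cdot> c i)"
    by (auto elim: spanE)
  then have "(\<Sum>i<m. E i \<cdot> (if i = k then - ((- 1) ^ k * (of_nat m * l + \<phi> y)) else c i)) = 0"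
    by (simp add: k scale_minus_right)
  then have "\<forall>i<m. (if i = k then - ((- 1) ^ k * (of_nat m * l + \<phi> y)) else c i) = 0"
    using ind unfolding independent_def by fast
  then have "- ((- 1) ^ k * (of_nat m * l + \<phi> y)) = 0" using k by (metis lessI)
  then have 0: "of_nat m * l + \<phi> y = 0" by simp
  show ?thesis
  \<comment> \<open>If \<open>l = 0\<close>, the factor in front of \<open>l\<close> is immaterial;
    otherwise the \<open>E i\<close> form a basis and \<open>m\<close> is the dimension.\<close>
  proof (cases "l = 0")
    case False
    then have "basis m E UNIV"
      using ind span_funpow_eq_UNIV[OF s' t' st _ m(1) y] by (simp add: basis_def E_def)
    then show ?thesis using 0 by (simp add: dim_eq)
  qed (use 0 in simp)
qed

text \<open>The roles of \<open>s\<close> and \<open>t\<close> are chosen so that the first map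
  needs at least as many steps to kill \<open>y\<close>; the second then kills \<open>y\<close>
  within that number of steps too.\<close>

lemma nilpotent_sum_supertrace_eq_0:
  fixes s t :: "'v \<Rightarrow> 'v"
  assumes s: "nilpotent s" and t: "nilpotent t"
    and st: "\<And>x. s x + t x = x \<cdot> l + y \<cdot> \<phi> x" and y: "y \<noteq> 0"
  shows "of_nat (dim UNIV) * l + \<phi> y = 0"
proof -
  define M where "M f = (LEAST k. (f ^^ k) y = 0)" for f :: "'v \<Rightarrow> 'v"
  have M: "(f ^^ M f) y = 0" "\<And>k. k < M f \<Longrightarrow> (f ^^ k) y \<noteq> 0" if f: "nilpotent f" for f
  proof -
    obtain k where "(f ^^ k) y = 0" using f unfolding nilpotent_def by metis
    then show "(f ^^ M f) y = 0" unfolding M_def by (rule LeastI)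
  qed (auto simp: M_def dest: not_less_Least)
  have high: "(f ^^ k) y = 0" if f: "nilpotent f" and "M f \<le> k" for f k
    using that M(1)[OF f] endo_zero[OF endo_funpow, of f]
    by (metis funpow_add le_add_diff_inverse2 o_apply nilpotent_def)
  show ?thesis
  proof (cases "M t \<le> M s")
    case True
    then show ?thesis using nilpotent_sum_funpow_eq_0[OF s t st y M[OF s] high[OF t]] by simp
  next
    case False
    have ts: "\<And>x. t x + s x = x \<cdot> l + y \<cdot> \<phi> x" using st by (simp add: add.commute)
    from False show ?thesis using nilpotent_sum_funpow_eq_0[OF t s ts y M[OF t] high[OF s]] by simp
  qed
qed

section \<open>The equivalence of the three conditions\<close>

theorem special_type_II_equivalences:
  assumes "special_type_II u"
  shows "(str u = {0} \<longleftrightarrow>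
           (\<exists>n e m. basis n e UNIV \<and> represents n e m u \<and> (\<forall>i<n. m i i = 0)))
       \<and> ((\<exists>n e m. basis n e UNIV \<and> represents n e m u \<and> (\<forall>i<n. m i i = 0)) \<longleftrightarrow>
           (\<exists>s t. nilpotent s \<and> nilpotent t \<and> u = (\<lambda>x. s x + t x)))"
proof -
  obtain l a where dim: "finite_dim UNIV" "dim UNIV \<ge> 2" and dec: "type_II_decomp u l a"
    using assms by (auto simp: special_type_II_def)
  then have l: "l \<in> center" and "rank_one a" by (simp_all add: type_II_decomp_def)
  from this(2) obtain y \<phi> where y: "y \<noteq> 0" and a: "a = (\<lambda>x. y \<cdot> \<phi> x)"
    and \<phi>: "\<And>x z. \<phi> (x + z) = \<phi> x + \<phi> z" "\<And>x c. \<phi> (x \<cdot> c) = \<phi> x * c" "\<exists>x. \<phi> x = 1"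
    by (rule rank_oneE) (rule that)
  have u: "u = (\<lambda>x. x \<cdot> l + y \<cdot> \<phi> x)" using dec by (simp add: type_II_decomp_def a)
  have "endo u"
    unfolding endo_def
  proof (intro conjI allI)
    show "u (x + z) = u x + u z" for x z
      by (simp add: u \<phi> scale_add_left scale_add_right algebra_simps)
    \<comment> \<open>Centrality of \<open>l\<close> makes \<open>x \<mapsto> x \<cdot> l\<close>
      compatible with scalars.\<close>
    have "c * l = l * c" for c using l by (simp add: center_def)
    then show "u (x \<cdot> c) = u x \<cdot> c" for x c
      by (simp add: u \<phi> scale_add_left flip: scale_mult)
  qed
  \<comment> \<open>This equation is the hub: it restates (i), and the implications from it to (ii),
    (iii) and back close a cycle.\<close>
  define zero_sum where "zero_sum \<longleftrightarrow> of_nat (dim UNIV) * l + \<phi> y = 0"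
  let ?diag = "\<exists>n e m. basis n e UNIV \<and> represents n e m u \<and> (\<forall>i<n. m i i = 0)"
  let ?nil = "\<exists>s t. nilpotent s \<and> nilpotent t \<and> u = (\<lambda>x. s x + t x)"
  have i: "str u = {0} \<longleftrightarrow> zero_sum"
    unfolding zero_sum_def using str_eq_0_iff[OF dec dim y a \<phi>(2,3)] .
  have ?diag if zero_sum
    using zero_diagonal_if[OF dim(1) y \<phi>] that by (simp add: zero_sum_def u)
  moreover have ?nil if ?diag
    using that by (elim exE conjE) (rule nilpotent_sum_if_zero_diagonal[OF _ _ _ \<open>endo u\<close>])
  moreover have zero_sum if nil: ?nil
  proof -
    obtain s t where st: "nilpotent s" "nilpotent t" "u = (\<lambda>x. s x + t x)" using nil by blast
    have "s x + t x = x \<cdot> l + y \<cdot> \<phi> x" for x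
      using fun_cong[OF st(3), of x] by (simp add: u)
    from nilpotent_sum_supertrace_eq_0[OF st(1,2) this y] show ?thesis by (simp add: zero_sum_def)
  qed
  ultimately show ?thesis using i by blast
qed

end

theorem proposition1p3:
  fixes scale :: "'v::ab_group_add \<Rightarrow> 'd::division_ring \<Rightarrow> 'v"
    and u :: "'v \<Rightarrow> 'v"
  assumes "right_vector_space scale"
    and "right_vector_space.finite_dim scale UNIV"
    and "right_vector_space.special_type_II scale u"
  shows "(right_vector_space.str scale u = {0} \<longleftrightarrow>
           (\<exists>n e m. right_vector_space.basis scale n e UNIV \<and>
              right_vector_space.represents scale n e m u \<and> (\<forall>i<n. m i i = 0)))
       \<and> ((\<exists>n e m. right_vector_space.basis scale n e UNIV \<and>
              right_vector_space.represents scale n e m u \<and> (\<forall>i<n. m i i = 0)) \<longleftrightarrow>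
           (\<exists>s t. right_vector_space.nilpotent scale s \<and> right_vector_space.nilpotent scale t \<and>
              u = (\<lambda>x. s x + t x)))"
  by (rule right_vector_space.special_type_II_equivalences[OF assms(1,3)])

end
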